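(* Let $\mathcal{S}$ be a translation surface in $\mathbf{Nil}$ containing two distinct translation curves $g_a$ and $g_b$. Let $A_1,A_2,A_3$ be three different points on $g_a$ and $B_1,B_2,B_3$ three different points on $g_b$, such that the translation curves $g_{A_1B_1}$, $g_{A_2B_2}$, $g_{A_3B_3}$, $g_{A_3B_2}$, $g_{A_1B_3}$, $g_{A_2B_1}$ are defined (the two points in each pair are distinct). If the translation curves $g_{A_1B_1}$, $g_{A_2B_2}$, $g_{A_3B_3}$ intersect the translation curves $g_{A_3B_2}$, $g_{A_1B_3}$, $g_{A_2B_1}$, respectively, then the three points of intersection $$M_1=g_{A_1B_1}\cap g_{A_3B_2},\qquad M_2=g_{A_2B_2}\cap g_{A_1B_3},\qquad M_3=g_{A_3B_3}\cap g_{A_2B_1}$$ all lie on one translation curve.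
   Context: $\mathbf{Nil}$ is $\mathbb{R}^3$ with the Heisenberg group structure; the translation by $(x,y,z)$ maps the point $(a,b,c)$ to $(x+a,\;y+b,\;z+bx+c)$. A translation curve is a curve whose tangent vector at each point is the image, under the translation carrying the origin to that point, of a fixed nonzero vector $(u,v,w)$ at the origin. Explicitly, the translation curve starting at $(a,b,c)$ with data $(u,v,w)\neq(0,0,0)$ is $$t\mapsto\Bigl(a+ut,\;b+vt,\;c+avt+wt+\tfrac12uvt^2\Bigr),\qquad t\in\mathbb{R}.$$ Any two distinct points $P,Q$ lie on exactly one (complete) translation curve, denoted $g_{PQ}$. For three points $P_1,P_2,P_3$ not lying on one translation curve, the translation surface $\mathcal{S}^{\mathbf{Nil},t}_{P_1P_2P_3}$ is the set of all points $P\in\mathbf{Nil}$ such that the tangent vectors at $P$ of the translation curves from $P$ to $P_1$, to $P_2$ and to $P_3$ are coplanar in the Euclidean sense (i.e. linearly dependent as vectors of $\mathbb{R}^3$); the points $P_1,P_2,P_3$ themselves are counted as belonging to the surface. A translation surface is a set of this form. *)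

theory Defs
  imports "HOL-Analysis.Analysis"
begin

type_synonym nil = "real \<times> real \<times> real"

fun nil_translation :: "nil \<Rightarrow> nil \<Rightarrow> nil" where
  "nil_translation (x, y, z) (a, b, c) = (x + a, y + b, z + b * x + c)"

fun nil_curve :: "nil \<Rightarrow> nil \<Rightarrow> real \<Rightarrow> nil" where
  "nil_curve (a, b, c) (u, v, w) t =
     (a + u * t, b + v * t, c + a * v * t + w * t + 1/2 * u * v * t^2)"

text \<open>The velocity of \<open>nil_curve P d\<close> at every point \<open>X\<close> is the image of \<open>d\<close> under the
  differential at the origin of the translation by \<open>X\<close>.\<close>

lemma nil_curve_velocity:
  fixes P d :: nil and t :: real
  shows "\<exists>D. (nil_translation (nil_curve P d t) has_derivative D) (at (0, 0, 0)) \<and>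
             (nil_curve P d has_vector_derivative D d) (at t)"
proof -
  obtain a b c where P: "P = (a, b, c)" by (cases P)
  obtain u v w where d: "d = (u, v, w)" by (cases d)
  have fun_eq: "nil_translation (x, y, z) = (\<lambda>p. (x + fst p, y + fst (snd p), z + fst (snd p) * x + snd (snd p)))"
    for x y z by auto
  define X where "X = a + u * t"
  have curve_t: "nil_curve P d t = (X, b + v * t, c + a * v * t + w * t + 1/2 * u * v * t^2)"
    by (simp add: P d X_def)
  have 1: "(nil_translation (nil_curve P d t) has_derivative
       (\<lambda>h. (fst h, fst (snd h), fst (snd h) * X + snd (snd h)))) (at (0, 0, 0))"
    unfolding curve_t fun_eq by (auto intro!: derivative_eq_intros)
  have curve_eq: "nil_curve P d =
      (\<lambda>t. (a + u * t, b + v * t, c + a * v * t + w * t + 1/2 * u * v * t^2))"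
    by (auto simp: P d)
  have 2: "(nil_curve P d has_vector_derivative (u, v, v * X + w)) (at t)"
    unfolding curve_eq X_def
    by (intro has_vector_derivative_Pair)
       (auto intro!: derivative_eq_intros
             simp: has_real_derivative_iff_has_vector_derivative[symmetric] algebra_simps)
  show ?thesis using 1 2 by (auto simp: d)
qed

definition nil_is_curve :: "nil set \<Rightarrow> bool" where
  "nil_is_curve g \<longleftrightarrow> (\<exists>P d. d \<noteq> (0, 0, 0) \<and> g = range (nil_curve P d))"

text \<open>Meaningful for \<open>P \<noteq> Q\<close> only, by \<open>nil_is_curve_ex1\<close> below.\<close>

definition nil_curve_through :: "nil \<Rightarrow> nil \<Rightarrow> nil set" where
  "nil_curve_through P Q = (THE g. nil_is_curve g \<and> P \<in> g \<and> Q \<in> g)"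

lemma nil_is_curve_ex1:
  assumes "P \<noteq> Q"
  shows "\<exists>!g. nil_is_curve g \<and> P \<in> g \<and> Q \<in> g"
proof -
  obtain a b c where P: "P = (a, b, c)" by (cases P)
  obtain x y z where Q: "Q = (x, y, z)" by (cases Q)
  define e where "e = (x - a, y - b, z - c - a * (y - b) - 1/2 * (x - a) * (y - b))"
  have e0: "e \<noteq> (0, 0, 0)" using assms by (auto simp: e_def P Q)
  have eQ: "nil_curve P e 1 = Q" by (simp add: e_def P Q)
  have eP: "nil_curve P e 0 = P" by (simp add: e_def P)
  have shift: "nil_curve R d (s + t) = nil_curve (nil_curve R d s) d t" for R d s t
    by (cases R; cases d) (simp add: power2_eq_square algebra_simps)
  have scale: "nil_curve R (k *\<^sub>R d) t = nil_curve R d (k * t)" for R d k t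
    by (cases R; cases d) (simp add: power2_eq_square algebra_simps)
  have uniq: "g = range (nil_curve P e)" if g: "nil_is_curve g" "P \<in> g" "Q \<in> g" for g
  proof -
    obtain R d where gR: "g = range (nil_curve R d)" using g(1) by (auto simp: nil_is_curve_def)
    obtain s where s: "P = nil_curve R d s" using g(2) gR by auto
    obtain r where r: "Q = nil_curve R d r" using g(3) gR by auto
    define k where "k = r - s"
    have k: "Q = nil_curve P d k" using shift[of R d s k] by (simp add: s r k_def)
    have k0: "k \<noteq> 0" using assms k by (cases d) (auto simp: P)
    have "range (nil_curve P d) = range (nil_curve R d)"
    proof (intro equalityI subsetI)
      fix X assume "X \<in> range (nil_curve P d)"
      then obtain t where "X = nil_curve (nil_curve R d s) d t" by (auto simp: s)
      then have "X = nil_curve R d (s + t)" by (simp add: shift)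
      then show "X \<in> range (nil_curve R d)" by blast
    next
      fix X assume "X \<in> range (nil_curve R d)"
      then obtain t where "X = nil_curve R d t" by auto
      then have "X = nil_curve P d (t - s)" using shift[of R d s "t - s"] by (simp add: s)
      then show "X \<in> range (nil_curve P d)" by blast
    qed
    moreover have "k *\<^sub>R d = e"
      using k unfolding e_def P Q by (cases d) (auto simp: power2_eq_square algebra_simps)
    moreover have "range (nil_curve P (k *\<^sub>R d)) = range (nil_curve P d)"
    proof (intro equalityI subsetI)
      fix X assume "X \<in> range (nil_curve P d)"
      then obtain t where "X = nil_curve P d t" by auto
      then have "X = nil_curve P (k *\<^sub>R d) (t / k)" using k0 by (simp add: scale)
      then show "X \<in> range (nil_curve P (k *\<^sub>R d))" by blast
    qed (auto simp: scale)
    ultimately show ?thesis using gR by simp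
  qed
  have "nil_is_curve (range (nil_curve P e)) \<and> P \<in> range (nil_curve P e) \<and> Q \<in> range (nil_curve P e)"
    using e0 rangeI[of "nil_curve P e" 0] rangeI[of "nil_curve P e" 1]
    unfolding eP eQ nil_is_curve_def by blast
  then show ?thesis using uniq by blast
qed

text \<open>\<open>T\<close> is tangent at \<open>P\<close> to the translation curve running from \<open>P\<close> to \<open>Q\<close>. It is determined
  only up to a positive factor (the parametrization is not normalized), and exists iff
  \<open>P \<noteq> Q\<close>.\<close>

definition nil_tangent_towards :: "nil \<Rightarrow> nil \<Rightarrow> nil \<Rightarrow> bool" where
  "nil_tangent_towards P Q T \<longleftrightarrow>
     (\<exists>d s. d \<noteq> (0, 0, 0) \<and> 0 < s \<and> nil_curve P d s = Q \<and>
            (nil_curve P d has_vector_derivative T) (at 0))"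

text \<open>Linear dependence of the family \<open>T1, T2, T3\<close>: unlike \<open>dependent {T1, T2, T3}\<close>, this holds
  whenever two of the vectors are equal.\<close>

definition lin_dependent3 :: "nil \<Rightarrow> nil \<Rightarrow> nil \<Rightarrow> bool" where
  "lin_dependent3 T1 T2 T3 \<longleftrightarrow>
     (\<exists>\<alpha> \<beta> \<gamma> :: real. (\<alpha> \<noteq> 0 \<or> \<beta> \<noteq> 0 \<or> \<gamma> \<noteq> 0) \<and>
        \<alpha> *\<^sub>R T1 + \<beta> *\<^sub>R T2 + \<gamma> *\<^sub>R T3 = 0)"

definition nil_surface :: "nil \<Rightarrow> nil \<Rightarrow> nil \<Rightarrow> nil set" where
  "nil_surface P1 P2 P3 = {P1, P2, P3} \<union>
     {P. \<exists>T1 T2 T3. nil_tangent_towards P P1 T1 \<and> nil_tangent_towards P P2 T2 \<and>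
           nil_tangent_towards P P3 T3 \<and> lin_dependent3 T1 T2 T3}"

definition nil_is_surface :: "nil set \<Rightarrow> bool" where
  "nil_is_surface S \<longleftrightarrow>
     (\<exists>P1 P2 P3. \<not> (\<exists>g. nil_is_curve g \<and> {P1, P2, P3} \<subseteq> g) \<and> S = nil_surface P1 P2 P3)"

end

theory Submission
  imports Defs begin

text \<open>The diffeomorphism \<open>(x, y, z) \<mapsto> (x, y, z - xy/2)\<close> (the passage to exponential coordinates)
  turns translation curves into straight lines. Being coplanar is preserved by its differential,
  so a translation surface becomes the plane through the three given points, and the claim becomes
  the affine Pappus theorem for two coplanar lines, which are either concurrent or parallel.\<close>

section \<open>Affine Pappus in plane coordinates\<close>

text \<open>The two lines are taken as coordinate axes, with points (a, 0) and (0, b). Their join is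
  written \<open>b * x + a * y = a * b\<close>, without division, so that a point may be the origin;
  \<open>ne\<close> keeps the equation from degenerating to 0 = 0.\<close>

lemma pappus_concurrent_det:
  fixes x1 y1 x2 y2 x3 y3 a1 a2 a3 b1 b2 b3 :: real
  assumes a: "distinct [a1, a2, a3]" and b: "distinct [b1, b2, b3]"
    and ne: "a1 \<noteq> 0 \<or> b1 \<noteq> 0" "a2 \<noteq> 0 \<or> b2 \<noteq> 0" "a3 \<noteq> 0 \<or> b3 \<noteq> 0"
      "a3 \<noteq> 0 \<or> b2 \<noteq> 0" "a1 \<noteq> 0 \<or> b3 \<noteq> 0" "a2 \<noteq> 0 \<or> b1 \<noteq> 0"
    and m1: "b1 * x1 + a1 * y1 = a1 * b1" "b2 * x1 + a3 * y1 = a3 * b2"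
    and m2: "b2 * x2 + a2 * y2 = a2 * b2" "b3 * x2 + a1 * y2 = a1 * b3"
    and m3: "b3 * x3 + a3 * y3 = a3 * b3" "b1 * x3 + a2 * y3 = a2 * b1"
  shows "(x2 - x1) * (y3 - y1) = (x3 - x1) * (y2 - y1)"
proof -
  \<comment> \<open>Elimination makes \<open>a * a' * (b - b')\<close> and
    \<open>b * b' * (a' - a)\<close> multiples of the determinant. If it vanished, one of a, a' and
    one of b, b' would be zero, and each combination contradicts distinctness or
    nondegeneracy.\<close>
  have nz: "b * a' - a * b' \<noteq> 0" 
    if "b * x + a * y = a * b" "b' * x + a' * y = a' * b'" "a \<noteq> a'" "b \<noteq> b'" "a \<noteq> 0 \<or> b \<noteq> 0" "a' \<noteq> 0 \<or> b' \<noteq> 0"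
    for a b a' b' x y :: real
  proof
    assume D: "b * a' - a * b' = 0"
    have "a * a' * (b - b') = (b * a' - a * b') * x" "b * b' * (a' - a) = (b * a' - a * b') * y"
      using that(1,2) by algebra+
    then have "a * a' = 0" "b * b' = 0" using D that(3,4) by auto
    then show False using D that by auto
  qed
  \<comment> \<open>the determinants of the three pairs of line equations, so that \<open>x\<close> and \<open>y\<close> below are Cramer's rule\<close>
  define D1 where "D1 = b1 * a3 - a1 * b2"
  define D2 where "D2 = b2 * a1 - a2 * b3"
  define D3 where "D3 = b3 * a2 - a3 * b1"
  have D: "D1 \<noteq> 0" "D2 \<noteq> 0" "D3 \<noteq> 0"
    unfolding D1_def D2_def D3_def
    using nz[OF m1] nz[OF m2] nz[OF m3] a b ne by auto
  have x: "D1 * x1 = a1 * a3 * (b1 - b2)" "D2 * x2 = a2 * a1 * (b2 - b3)" "D3 * x3 = a3 * a2 * (b3 - b1)"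
    unfolding D1_def D2_def D3_def using m1 m2 m3 by algebra+
  have y: "D1 * y1 = b1 * b2 * (a3 - a1)" "D2 * y2 = b2 * b3 * (a1 - a2)" "D3 * y3 = b3 * b1 * (a2 - a3)"
    unfolding D1_def D2_def D3_def using m1 m2 m3 by algebra+
  \<comment> \<open>This is the 3x3 determinant of the homogeneous coordinates (D x, D y, D) of the
    three meeting points, expanded along the column of the D's.\<close>
  have "D1 * D2 * D3 * ((x2 - x1) * (y3 - y1) - (x3 - x1) * (y2 - y1))
     = D1 * ((D2 * x2) * (D3 * y3) - (D3 * x3) * (D2 * y2))
     - D2 * ((D1 * x1) * (D3 * y3) - (D3 * x3) * (D1 * y1))
     + D3 * ((D1 * x1) * (D2 * y2) - (D2 * x2) * (D1 * y1))"
    by algebra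
  \<comment> \<open>As polynomials, the three rows weighted by \<open>a2 * b3\<close>,
    \<open>a3 * b1\<close> and \<open>a1 * b2\<close> add up to zero, so the determinant vanishes
    identically.\<close>
  also have "\<dots> = 0"
    unfolding x y unfolding D1_def D2_def D3_def by algebra
  finally show ?thesis using D by simp
qed

text \<open>The lines are now y = 0 and y = 1, with points (a, 0) and (b, 1). The join of two such
  points has abscissa \<open>a + y * (b - a)\<close> at height y.\<close>

lemma pappus_parallel_det:
  fixes x1 y1 x2 y2 x3 y3 a1 a2 a3 b1 b2 b3 :: real
  assumes a: "distinct [a1, a2, a3]"
    and m1: "x1 = a1 + y1 * (b1 - a1)" "x1 = a3 + y1 * (b2 - a3)"
    and m2: "x2 = a2 + y2 * (b2 - a2)" "x2 = a1 + y2 * (b3 - a1)"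
    and m3: "x3 = a3 + y3 * (b3 - a3)" "x3 = a2 + y3 * (b1 - a2)"
  shows "(x2 - x1) * (y3 - y1) = (x3 - x1) * (y2 - y1)"
proof -
  define D1 where "D1 = (b1 - a1) - (b2 - a3)"
  define D2 where "D2 = (b2 - a2) - (b3 - a1)"
  define D3 where "D3 = (b3 - a3) - (b1 - a2)"
  have y: "D1 * y1 = a3 - a1" "D2 * y2 = a1 - a2" "D3 * y3 = a2 - a3"
    unfolding D1_def D2_def D3_def using m1 m2 m3 by algebra+
  \<comment> \<open>The right-hand sides in \<open>y\<close> are differences of distinct numbers, so
    no left-hand factor can be zero.\<close>
  have D: "D1 \<noteq> 0" "D2 \<noteq> 0" "D3 \<noteq> 0"
    using y a by auto
  have x: "D1 * x1 = D1 * a1 + (a3 - a1) * (b1 - a1)" "D2 * x2 = D2 * a2 + (a1 - a2) * (b2 - a2)"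
     "D3 * x3 = D3 * a3 + (a2 - a3) * (b3 - a3)"
    unfolding y[symmetric] m1(1) m2(1) m3(1) by algebra+
  have "D1 * D2 * D3 * ((x2 - x1) * (y3 - y1) - (x3 - x1) * (y2 - y1))
     = D1 * ((D2 * x2) * (D3 * y3) - (D3 * x3) * (D2 * y2))
     - D2 * ((D1 * x1) * (D3 * y3) - (D3 * x3) * (D1 * y1))
     + D3 * ((D1 * x1) * (D2 * y2) - (D2 * x2) * (D1 * y1))"
    by algebra
  \<comment> \<open>In this case the rows (D x, D y, D) simply add up to zero.\<close>
  also have "\<dots> = 0"
    unfolding x y unfolding D1_def D2_def D3_def by algebra
  finally show ?thesis using D by simp
qed

section \<open>Dependence, coordinates and collinearity in a real vector space\<close>

text \<open>The dimension bound counts elements of sets, where a repeated vector would be lost; a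
  repetition therefore gets its own relation, with coefficients 1 and -1.\<close>

lemma three_in_span_pair:
  fixes d e w p q :: "'a::real_vector"
  assumes "{d, e, w} \<subseteq> span {p, q}"
  obtains \<alpha> \<beta> \<gamma> where "\<alpha> \<noteq> 0 \<or> \<beta> \<noteq> 0 \<or> \<gamma> \<noteq> 0" "\<alpha> *\<^sub>R d + \<beta> *\<^sub>R e + \<gamma> *\<^sub>R w = 0"
proof (cases "distinct [d, e, w]")
  case True
  have "card {p, q} < card {d, e, w}"
    using True by (simp add: card_insert_if)
  then have "dependent {d, e, w}"
    using independent_span_bound[of "{p, q}" "{d, e, w}"] assms by fastforce
  then obtain u where "\<exists>v\<in>{d, e, w}. u v \<noteq> 0" "(\<Sum>v\<in>{d, e, w}. u v *\<^sub>R v) = 0"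
    by (subst (asm) dependent_finite) auto
  then show thesis
    using True that[of "u d" "u e" "u w"] by (auto simp: add.assoc)
next
  case False
  then consider "d = e" | "d = w" | "e = w" by auto
  then show thesis
    using that[of 1 "-1" 0] that[of 1 0 "-1"] that[of 0 1 "-1"] by cases auto
qed

lemma independent_pair_eq:
  fixes p q :: "'a::real_vector"
  assumes "independent {p, q}" "p \<noteq> q"
    and "O' + x *\<^sub>R p + y *\<^sub>R q = O' + x' *\<^sub>R p + y' *\<^sub>R q"
  shows "x = x' \<and> y = y'"
proof (rule ccontr)
  assume ne: "\<not> ?thesis"
  define u where "u v = (if v = p then x - x' else y - y')" for v
  have "(\<Sum>v\<in>{p, q}. u v *\<^sub>R v) = 0" "\<exists>v\<in>{p, q}. u v \<noteq> 0"
    using assms(2,3) ne by (auto simp: u_def algebra_simps)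
  then have "dependent {p, q}"
    by (subst dependent_finite) auto
  then show False using assms(1) by simp
qed

lemma collinear_3_diff: "collinear {a, b, c} \<longleftrightarrow> collinear {0, b - a, c - a}"
  using collinear_3[of b a c] by (simp only: NO_MATCH_def insert_commute simp_thms)

lemma collinear_3_param:
  assumes "collinear {A, B, M}" "A \<noteq> B"
  obtains s where "M = A + s *\<^sub>R (B - A)"
proof -
  have "collinear {0, B - A, M - A}"
    using assms(1) by (subst (asm) collinear_3_diff)
  then show thesis
  proof (cases "M = A")
    case False
    then obtain s where "M - A = s *\<^sub>R (B - A)"
      using \<open>collinear {0, B - A, M - A}\<close> assms(2) unfolding collinear_lemma by auto
    then show thesis
      using that[of s] by (simp add: algebra_simps)
  qed (use that[of 0] in simp)
qed

text \<open>When the determinant vanishes, dividing by a nonzero coordinate of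
  \<open>M2 - M1\<close> exhibits \<open>M3 - M1\<close> as a multiple of it; if both coordinates
  are zero, then \<open>M2 = M1\<close>.\<close>

lemma collinear_frame:
  fixes O' p q :: "'a::real_vector"
  assumes "M1 = O' + x1 *\<^sub>R p + y1 *\<^sub>R q" "M2 = O' + x2 *\<^sub>R p + y2 *\<^sub>R q"
    "M3 = O' + x3 *\<^sub>R p + y3 *\<^sub>R q"
    and det: "(x2 - x1) * (y3 - y1) = (x3 - x1) * (y2 - y1)"
  shows "collinear {M1, M2, M3}"
proof -
  have 2: "M2 - M1 = (x2 - x1) *\<^sub>R p + (y2 - y1) *\<^sub>R q"
    and 3: "M3 - M1 = (x3 - x1) *\<^sub>R p + (y3 - y1) *\<^sub>R q"
    using assms by (simp_all add: algebra_simps)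
  have x: "(x2 - x1) *\<^sub>R (M3 - M1) = (x3 - x1) *\<^sub>R (M2 - M1)"
    unfolding 2 3 using det by (simp add: scaleR_add_right)
  have y: "(y2 - y1) *\<^sub>R (M3 - M1) = (y3 - y1) *\<^sub>R (M2 - M1)"
    unfolding 2 3 using det by (simp add: scaleR_add_right mult.commute)
  have "M2 - M1 = 0 \<or> (\<exists>c. M3 - M1 = c *\<^sub>R (M2 - M1))"
  proof (cases "x2 - x1 = 0")
    case True
    show ?thesis
    proof (cases "y2 - y1 = 0")
      case False
      have "M3 - M1 = ((y3 - y1) / (y2 - y1)) *\<^sub>R (M2 - M1)"
        using y False by (simp add: eq_vector_fraction_iff)
      then show ?thesis by blast
    qed (use True 2 in simp)
  next
    case False
    have "M3 - M1 = ((x3 - x1) / (x2 - x1)) *\<^sub>R (M2 - M1)"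
      using x False by (simp add: eq_vector_fraction_iff)
    then show ?thesis by blast
  qed
  then have "collinear {0, M2 - M1, M3 - M1}"
    unfolding collinear_lemma by blast
  then show ?thesis
    by (subst collinear_3_diff)
qed

section \<open>Pappus for two coplanar lines\<close>

text \<open>The frame has its origin \<open>O'\<close> at the meeting point of the lines and
  \<open>p\<close>, \<open>q\<close> along them, which reduces the claim to
  \<open>pappus_concurrent_det\<close>.\<close>

lemma pappus_concurrent:
  fixes O' p q :: "'a::real_vector" and a1 a2 a3 b1 b2 b3 :: real
  assumes ind: "independent {p, q}" "p \<noteq> q"
    and A: "A1 = O' + a1 *\<^sub>R p" "A2 = O' + a2 *\<^sub>R p" "A3 = O' + a3 *\<^sub>R p"
    and B: "B1 = O' + b1 *\<^sub>R q" "B2 = O' + b2 *\<^sub>R q" "B3 = O' + b3 *\<^sub>R q"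
    and dist: "distinct [A1, A2, A3]" "distinct [B1, B2, B3]"
    and ne: "A1 \<noteq> B1" "A2 \<noteq> B2" "A3 \<noteq> B3" "A3 \<noteq> B2" "A1 \<noteq> B3" "A2 \<noteq> B1"
    and M: "collinear {A1, B1, M1}" "collinear {A3, B2, M1}"
      "collinear {A2, B2, M2}" "collinear {A1, B3, M2}"
      "collinear {A3, B3, M3}" "collinear {A2, B1, M3}"
  shows "collinear {M1, M2, M3}"
proof -
  \<comment> \<open>Each join parametrizes M; independence of \<open>p\<close> and \<open>q\<close>
    identifies the two coordinate pairs, so a single pair satisfies both line equations.\<close>
  have meet: "\<exists>x y. M = O' + x *\<^sub>R p + y *\<^sub>R q \<and> b * x + a * y = a * b \<and> b' * x + a' * y = a' * b'"
    if coll: "collinear {A, B, M}" "collinear {A', B', M}" and ne: "A \<noteq> B" "A' \<noteq> B'"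
      and eqs: "A = O' + a *\<^sub>R p" "B = O' + b *\<^sub>R q" "A' = O' + a' *\<^sub>R p" "B' = O' + b' *\<^sub>R q"
    for A B A' B' M :: 'a and a b a' b'
  proof -
    obtain s where "M = A + s *\<^sub>R (B - A)"
      using collinear_3_param[OF coll(1) ne(1)] .
    then have s: "M = O' + (a - s * a) *\<^sub>R p + (s * b) *\<^sub>R q"
      by (simp add: eqs algebra_simps)
    obtain t where "M = A' + t *\<^sub>R (B' - A')"
      using collinear_3_param[OF coll(2) ne(2)] .
    then have t: "M = O' + (a' - t * a') *\<^sub>R p + (t * b') *\<^sub>R q"
      by (simp add: eqs algebra_simps)
    have "a - s * a = a' - t * a'" "s * b = t * b'"
      using independent_pair_eq[OF ind s[unfolded t]] by auto
    then have "b * (a - s * a) + a * (s * b) = a * b" "b' * (a - s * a) + a' * (s * b) = a' * b'"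
      by algebra+
    then show ?thesis using s by blast
  qed
  obtain x1 y1 where 1: "M1 = O' + x1 *\<^sub>R p + y1 *\<^sub>R q"
      "b1 * x1 + a1 * y1 = a1 * b1" "b2 * x1 + a3 * y1 = a3 * b2"
    using meet[OF M(1,2) ne(1,4) A(1) B(1) A(3) B(2)] by blast
  obtain x2 y2 where 2: "M2 = O' + x2 *\<^sub>R p + y2 *\<^sub>R q"
      "b2 * x2 + a2 * y2 = a2 * b2" "b3 * x2 + a1 * y2 = a1 * b3"
    using meet[OF M(3,4) ne(2,5) A(2) B(2) A(1) B(3)] by blast
  obtain x3 y3 where 3: "M3 = O' + x3 *\<^sub>R p + y3 *\<^sub>R q"
      "b3 * x3 + a3 * y3 = a3 * b3" "b1 * x3 + a2 * y3 = a2 * b1"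
    using meet[OF M(5,6) ne(3,6) A(3) B(3) A(2) B(1)] by blast
  have "(x2 - x1) * (y3 - y1) = (x3 - x1) * (y2 - y1)"
    using dist ne unfolding A B
    by (intro pappus_concurrent_det[OF _ _ _ _ _ _ _ _ 1(2,3) 2(2,3) 3(2,3)]) auto
  then show ?thesis
    by (rule collinear_frame[OF 1(1) 2(1) 3(1)])
qed

text \<open>Here \<open>p\<close> is the common direction and \<open>q\<close> leads from one line
  to the other, so the lines have heights 0 and 1 as in \<open>pappus_parallel_det\<close>.\<close>

lemma pappus_parallel:
  fixes O' p q :: "'a::real_vector" and a1 a2 a3 b1 b2 b3 :: real
  assumes ind: "independent {p, q}" "p \<noteq> q"
    and A: "A1 = O' + a1 *\<^sub>R p" "A2 = O' + a2 *\<^sub>R p" "A3 = O' + a3 *\<^sub>R p"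
    and B: "B1 = O' + b1 *\<^sub>R p + q" "B2 = O' + b2 *\<^sub>R p + q" "B3 = O' + b3 *\<^sub>R p + q"
    and dist: "distinct [A1, A2, A3]"
    and ne: "A1 \<noteq> B1" "A2 \<noteq> B2" "A3 \<noteq> B3" "A3 \<noteq> B2" "A1 \<noteq> B3" "A2 \<noteq> B1"
    and M: "collinear {A1, B1, M1}" "collinear {A3, B2, M1}"
      "collinear {A2, B2, M2}" "collinear {A1, B3, M2}"
      "collinear {A3, B3, M3}" "collinear {A2, B1, M3}"
  shows "collinear {M1, M2, M3}"
proof -
  \<comment> \<open>The height y of M equals its parameter along either join, because both joins run
    from height 0 to height 1.\<close>
  have meet: "\<exists>x y. M = O' + x *\<^sub>R p + y *\<^sub>R q \<and> x = a + y * (b - a) \<and> x = a' + y * (b' - a')"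
    if coll: "collinear {A, B, M}" "collinear {A', B', M}" and ne: "A \<noteq> B" "A' \<noteq> B'"
      and eqs: "A = O' + a *\<^sub>R p" "B = O' + b *\<^sub>R p + q" "A' = O' + a' *\<^sub>R p" "B' = O' + b' *\<^sub>R p + q"
    for A B A' B' M :: 'a and a b a' b'
  proof -
    obtain s where "M = A + s *\<^sub>R (B - A)"
      using collinear_3_param[OF coll(1) ne(1)] .
    then have s: "M = O' + (a + s * (b - a)) *\<^sub>R p + s *\<^sub>R q"
      by (simp add: eqs algebra_simps)
    obtain t where "M = A' + t *\<^sub>R (B' - A')"
      using collinear_3_param[OF coll(2) ne(2)] .
    then have t: "M = O' + (a' + t * (b' - a')) *\<^sub>R p + t *\<^sub>R q"
      by (simp add: eqs algebra_simps)
    have "a + s * (b - a) = a' + t * (b' - a')" "s = t"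
      using independent_pair_eq[OF ind s[unfolded t]] by auto
    then show ?thesis using s by blast
  qed
  obtain x1 y1 where 1: "M1 = O' + x1 *\<^sub>R p + y1 *\<^sub>R q"
      "x1 = a1 + y1 * (b1 - a1)" "x1 = a3 + y1 * (b2 - a3)"
    using meet[OF M(1,2) ne(1,4) A(1) B(1) A(3) B(2)] by blast
  obtain x2 y2 where 2: "M2 = O' + x2 *\<^sub>R p + y2 *\<^sub>R q"
      "x2 = a2 + y2 * (b2 - a2)" "x2 = a1 + y2 * (b3 - a1)"
    using meet[OF M(3,4) ne(2,5) A(2) B(2) A(1) B(3)] by blast
  obtain x3 y3 where 3: "M3 = O' + x3 *\<^sub>R p + y3 *\<^sub>R q"
      "x3 = a3 + y3 * (b3 - a3)" "x3 = a2 + y3 * (b1 - a2)"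
    using meet[OF M(5,6) ne(3,6) A(3) B(3) A(2) B(1)] by blast
  have "(x2 - x1) * (y3 - y1) = (x3 - x1) * (y2 - y1)"
    using dist unfolding A
    by (intro pappus_parallel_det[OF _ 1(2,3) 2(2,3) 3(2,3)]) auto
  then show ?thesis
    by (rule collinear_frame[OF 1(1) 2(1) 3(1)])
qed

lemma not_independent_pairD:
  fixes p q :: "'a::real_vector"
  assumes "\<not> (independent {p, q} \<and> p \<noteq> q)" "p \<noteq> 0"
  obtains k where "q = k *\<^sub>R p"
proof (cases "p = q")
  case True
  then show thesis using that[of 1] by simp
next
  case False
  then have "q \<in> span {p}"
    using assms by (auto simp: insert_commute[of p] independent_insert)
  then show thesis using that by (auto simp: span_singleton)
qed

text \<open>With \<open>d\<close>, \<open>e\<close> the directions of the lines and \<open>f\<close>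
  joining them, coplanarity gives a linear relation. If \<open>d\<close> and \<open>e\<close> are
  independent, it expresses \<open>f\<close> by them and so locates a common point; otherwise the
  lines are parallel.\<close>

lemma pappus:
  fixes A1 A2 A3 B1 B2 B3 M1 M2 M3 :: "'a::real_vector"
  assumes coplanar: "{A1, A2, A3, B1, B2, B3} \<subseteq> affine hull {u, v, w}"
    and noncoll: "\<not> collinear {A1, A2, A3, B1, B2, B3}"
    and A: "collinear {A1, A2, A3}" and B: "collinear {B1, B2, B3}"
    and dist: "distinct [A1, A2, A3]" "distinct [B1, B2, B3]"
    and ne: "A1 \<noteq> B1" "A2 \<noteq> B2" "A3 \<noteq> B3" "A3 \<noteq> B2" "A1 \<noteq> B3" "A2 \<noteq> B1"
    and M: "collinear {A1, B1, M1}" "collinear {A3, B2, M1}"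
      "collinear {A2, B2, M2}" "collinear {A1, B3, M2}"
      "collinear {A3, B3, M3}" "collinear {A2, B1, M3}"
  shows "collinear {M1, M2, M3}"
proof -
  define d where "d = A2 - A1"
  define e where "e = B2 - B1"
  define f where "f = B1 - A1"
  have d0: "d \<noteq> 0" and e0: "e \<noteq> 0" using dist by (auto simp: d_def e_def)
  obtain a3 where a3: "A3 = A1 + a3 *\<^sub>R d"
    using collinear_3_param[OF A] dist unfolding d_def by auto
  obtain b3 where b3: "B3 = B1 + b3 *\<^sub>R e"
    using collinear_3_param[OF B] dist unfolding e_def by auto
  have A2: "A2 = A1 + d" and B1: "B1 = A1 + f" and B2: "B2 = A1 + f + e"
    by (simp_all add: d_def e_def f_def)
  \<comment> \<open>Otherwise all six points would lie on the line through \<open>A1\<close> in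
    direction \<open>d\<close>. In the parallel case this makes \<open>d\<close> and
    \<open>f\<close> independent.\<close>
  have line: False if "f = k *\<^sub>R d" "e = l *\<^sub>R d" for k l
  proof -
    have "\<forall>x\<in>{A1, A2, A3, B1, B2, B3}. \<exists>c. x = A1 + c *\<^sub>R d"
      unfolding A2 B1 B2 a3 b3 that
      by (auto intro: exI[of _ 0] exI[of _ 1] exI[of _ k] exI[of _ "k + l"] exI[of _ "k + b3 * l"]
          simp: algebra_simps)
    then show False using noncoll unfolding collinear_alt by blast
  qed
  have "{d, e, f} \<subseteq> span {v - u, w - u}"
  proof -
    have "x - y \<in> span {v - u, w - u}" if "x \<in> affine hull {u, v, w}" "y \<in> affine hull {u, v, w}" for x y
      using that unfolding affine_hull_insert_span_gen
      by (auto intro: span_diff)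
    then show ?thesis using coplanar by (auto simp: d_def e_def f_def)
  qed
  then obtain \<alpha> \<beta> \<gamma> where nz: "\<alpha> \<noteq> 0 \<or> \<beta> \<noteq> 0 \<or> \<gamma> \<noteq> 0"
    and dep: "\<alpha> *\<^sub>R d + \<beta> *\<^sub>R e + \<gamma> *\<^sub>R f = 0"
    using three_in_span_pair by metis
  show ?thesis
  proof (cases "independent {d, e} \<and> d \<noteq> e")
    case True
    have g0: "\<gamma> \<noteq> 0"
    proof
      assume "\<gamma> = 0"
      then have "0 + \<alpha> *\<^sub>R d + \<beta> *\<^sub>R e = 0 + 0 *\<^sub>R d + 0 *\<^sub>R e" using dep by simp
      then show False using independent_pair_eq True nz \<open>\<gamma> = 0\<close> by blast
    qed
    define s where "s = - \<alpha> / \<gamma>"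
    define t where "t = - \<beta> / \<gamma>"
    have "\<gamma> *\<^sub>R f = \<gamma> *\<^sub>R (s *\<^sub>R d + t *\<^sub>R e)"
      using dep g0 by (simp add: s_def t_def algebra_simps eq_neg_iff_add_eq_0)
    then have f: "f = s *\<^sub>R d + t *\<^sub>R e" using g0 by simp
    show ?thesis
      \<comment> \<open>The lines meet at \<open>A1 + s *\<^sub>R d\<close>; the remaining numbers
        are the positions of the points measured from there, in units of \<open>d\<close> and
        \<open>e\<close>.\<close>
      by (rule pappus_concurrent[of d e A1 "A1 + s *\<^sub>R d" "- s" A2 "1 - s" A3 "a3 - s" B1 t B2 "t + 1" B3 "t + b3"])
        (use True dist ne M in \<open>simp_all add: a3 b3 A2 B1 B2 f algebra_simps\<close>)
  next
    case False
    then obtain k where k: "e = k *\<^sub>R d" using not_independent_pairD d0 by metis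
    have ind: "independent {d, f} \<and> d \<noteq> f"
      using not_independent_pairD[of d f] d0 line[OF _ k] by metis
    show ?thesis
      by (rule pappus_parallel[of d f A1 A1 0 A2 1 A3 a3 B1 0 B2 k B3 "b3 * k"])
        (use ind dist ne M in \<open>simp_all add: a3 b3 A2 B1 B2 k algebra_simps\<close>)
  qed
qed

section \<open>Straightening translation curves\<close>

fun nil_straighten :: "nil \<Rightarrow> nil" where
  "nil_straighten (x, y, z) = (x, y, z - x * y / 2)"

fun nil_straighten_deriv :: "nil \<Rightarrow> nil \<Rightarrow> nil" where
  "nil_straighten_deriv (a, b, c) (u, v, w) = (u, v, w - (a * v + b * u) / 2)"

lemma inj_nil_straighten: "inj nil_straighten"
  by (rule injI) (auto elim!: nil_straighten.elims)

lemma linear_nil_straighten_deriv: "linear (nil_straighten_deriv P)"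
  by (cases P) (rule linearI; clarsimp simp: field_simps)

text \<open>The quadratic term of the curve is exactly half the product of the linear terms of x and
  y, so subtracting xy/2 removes it.\<close>

lemma nil_straighten_curve:
  "nil_straighten (nil_curve (a, b, c) (u, v, w) t) =
     nil_straighten (a, b, c) + t *\<^sub>R (u, v, w + (a * v - b * u) / 2)"
  by (simp add: field_simps power2_eq_square)

text \<open>Translation curves straighten to lines, and injectivity allows each line to be pulled
  back to a curve. This converts incidence in Nil into Euclidean collinearity, coincident points
  included.\<close>

lemma subset_nil_curve_iff:
  "(\<exists>g. nil_is_curve g \<and> X \<subseteq> g) \<longleftrightarrow> collinear (nil_straighten ` X)"
proof
  assume "\<exists>g. nil_is_curve g \<and> X \<subseteq> g"
  then obtain P d where X: "X \<subseteq> range (nil_curve P d)"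
    unfolding nil_is_curve_def by auto
  obtain a b c u v w where "P = (a, b, c)" "d = (u, v, w)" by (cases P; cases d)
  then have "\<forall>x\<in>nil_straighten ` X. \<exists>t. x = nil_straighten P + t *\<^sub>R (u, v, w + (a * v - b * u) / 2)"
    using X nil_straighten_curve[of a b c u v w] by blast
  then show "collinear (nil_straighten ` X)"
    unfolding collinear_alt by blast
next
  assume "collinear (nil_straighten ` X)"
  then obtain p d where pd: "\<forall>x\<in>X. \<exists>t. nil_straighten x = p + t *\<^sub>R d"
    unfolding collinear_alt by auto
  \<comment> \<open>The direction supplied by \<open>collinear_alt\<close> may be zero when X has at
    most one point, whereas a translation curve needs nonzero data; any nonzero vector then
    serves.\<close>
  have "\<exists>e. e \<noteq> 0 \<and> (\<forall>x\<in>X. \<exists>t. nil_straighten x = p + t *\<^sub>R e)"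
  proof (cases "d = 0")
    case True
    have "(1, 0, 0) \<noteq> (0 :: nil)" by (simp add: zero_prod_def)
    moreover have "\<forall>x\<in>X. nil_straighten x = p + 0 *\<^sub>R (1, 0, 0)"
      using pd True by (simp add: zero_prod_def[symmetric])
    ultimately show ?thesis by blast
  qed (use pd in blast)
  then obtain e where e: "e \<noteq> 0" "\<forall>x\<in>X. \<exists>t. nil_straighten x = p + t *\<^sub>R e"
    by blast
  obtain a b c u v w where p: "p = (a, b, c)" and uvw: "e = (u, v, w)" by (cases p; cases e)
  \<comment> \<open>\<open>P\<close> is the preimage of \<open>p\<close>, and \<open>D\<close>
    undoes the correction of the third component in \<open>nil_straighten_curve\<close>, so the
    curve straightens to the given line.\<close>
  define P where "P = (a, b, c + a * b / 2)"
  define D where "D = (u, v, w - (a * v - b * u) / 2)"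
  have "D \<noteq> (0, 0, 0)" using e(1) by (auto simp: D_def uvw zero_prod_def)
  moreover have "x \<in> range (nil_curve P D)" if x: "x \<in> X" for x
  proof -
    obtain t where "nil_straighten x = p + t *\<^sub>R e" using e(2) x by blast
    also have "\<dots> = nil_straighten (nil_curve P D t)"
      unfolding P_def D_def nil_straighten_curve by (simp add: p uvw)
    finally show ?thesis using inj_nil_straighten by (auto dest: injD)
  qed
  ultimately show "\<exists>g. nil_is_curve g \<and> X \<subseteq> g"
    unfolding nil_is_curve_def by blast
qed

lemma nil_curve_through_collinear:
  assumes "A \<noteq> B" "M \<in> nil_curve_through A B"
  shows "collinear {nil_straighten A, nil_straighten B, nil_straighten M}"
proof -
  let ?g = "nil_curve_through A B"
  have "nil_is_curve ?g \<and> A \<in> ?g \<and> B \<in> ?g"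
    unfolding nil_curve_through_def by (rule theI'[OF nil_is_curve_ex1[OF assms(1)]])
  then have "\<exists>g. nil_is_curve g \<and> {A, B, M} \<subseteq> g"
    using assms(2) by blast
  then show ?thesis
    unfolding subset_nil_curve_iff by simp
qed

section \<open>Translation surfaces as planes\<close>

text \<open>The differential sends the velocity at P to the constant velocity of the straightened
  curve, so following it for time s leads straight to the image of Q.\<close>

lemma nil_tangent_towards_straighten:
  assumes "nil_tangent_towards P Q T"
  obtains s where "0 < s" "nil_straighten Q = nil_straighten P + s *\<^sub>R nil_straighten_deriv P T"
proof -
  obtain d s where s: "0 < s" "nil_curve P d s = Q" and T: "(nil_curve P d has_vector_derivative T) (at 0)"
    using assms unfolding nil_tangent_towards_def by blast
  obtain a b c u v w where P: "P = (a, b, c)" and d: "d = (u, v, w)" by (cases P; cases d)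
  have "nil_curve P d = (\<lambda>t. (a + u * t, b + v * t, c + a * v * t + w * t + 1/2 * u * v * t^2))"
    by (auto simp: P d)
  then have "(nil_curve P d has_vector_derivative (u, v, a * v + w)) (at 0)"
    by (simp only:, intro has_vector_derivative_Pair)
       (auto intro!: derivative_eq_intros
             simp: has_real_derivative_iff_has_vector_derivative[symmetric] algebra_simps)
  then have "T = (u, v, a * v + w)"
    using T vector_derivative_unique_at by blast
  then have "nil_straighten Q = nil_straighten P + s *\<^sub>R nil_straighten_deriv P T"
    unfolding s(2)[symmetric] P d nil_straighten_curve by (simp add: field_simps)
  then show thesis using that s(1) by blast
qed

text \<open>A linear relation between the tangents becomes one between the vectors from the image of
  P to the images of the three points. Solving it for the image of P gives barycentric
  coordinates.\<close>

lemma nil_surface_subset_plane: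
  assumes noncoll: "\<not> collinear {nil_straighten P1, nil_straighten P2, nil_straighten P3}"
    and "P \<in> nil_surface P1 P2 P3"
  shows "nil_straighten P \<in> affine hull {nil_straighten P1, nil_straighten P2, nil_straighten P3}"
proof (cases "P \<in> {P1, P2, P3}")
  case True
  then show ?thesis by (auto intro: hull_inc)
next
  case False
  let ?f = nil_straighten and ?L = "nil_straighten_deriv P"
  obtain T1 T2 T3 where T: "nil_tangent_towards P P1 T1" "nil_tangent_towards P P2 T2"
      "nil_tangent_towards P P3 T3" and dep: "lin_dependent3 T1 T2 T3"
    using assms(2) False unfolding nil_surface_def by blast
  obtain s1 where s1: "0 < s1" "?f P1 = ?f P + s1 *\<^sub>R ?L T1"
    using nil_tangent_towards_straighten[OF T(1)] .
  obtain s2 where s2: "0 < s2" "?f P2 = ?f P + s2 *\<^sub>R ?L T2"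
    using nil_tangent_towards_straighten[OF T(2)] .
  obtain s3 where s3: "0 < s3" "?f P3 = ?f P + s3 *\<^sub>R ?L T3"
    using nil_tangent_towards_straighten[OF T(3)] .
  obtain \<alpha> \<beta> \<gamma> where nz: "\<alpha> \<noteq> 0 \<or> \<beta> \<noteq> 0 \<or> \<gamma> \<noteq> 0"
    and sum: "\<alpha> *\<^sub>R T1 + \<beta> *\<^sub>R T2 + \<gamma> *\<^sub>R T3 = 0"
    using dep unfolding lin_dependent3_def by blast
  \<comment> \<open>Each difference such as \<open>?f P1 - ?f P\<close> is a positive multiple of a
    transformed tangent; dividing the coefficients by these factors compensates for the
    lengths.\<close>
  define x where "x = \<alpha> / s1"
  define y where "y = \<beta> / s2"
  define z where "z = \<gamma> / s3"
  have nz: "x \<noteq> 0 \<or> y \<noteq> 0 \<or> z \<noteq> 0" using nz s1 s2 s3 by (auto simp: x_def y_def z_def)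
  interpret L: linear ?L by (rule linear_nil_straighten_deriv)
  have "x *\<^sub>R (?f P1 - ?f P) + y *\<^sub>R (?f P2 - ?f P) + z *\<^sub>R (?f P3 - ?f P)
      = \<alpha> *\<^sub>R ?L T1 + \<beta> *\<^sub>R ?L T2 + \<gamma> *\<^sub>R ?L T3"
    using s1 s2 s3 by (simp add: x_def y_def z_def)
  also have "\<dots> = ?L (\<alpha> *\<^sub>R T1 + \<beta> *\<^sub>R T2 + \<gamma> *\<^sub>R T3)"
    by (simp add: L.add L.scale)
  also have "\<dots> = 0" unfolding sum by (rule L.zero)
  finally have eq: "x *\<^sub>R ?f P1 + y *\<^sub>R ?f P2 + z *\<^sub>R ?f P3 = (x + y + z) *\<^sub>R ?f P"
    by (simp add: algebra_simps)
  \<comment> \<open>With sum zero, P would drop out and leave a nontrivial relation between the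
    edges of the triangle, contradicting \<open>noncoll\<close>.\<close>
  have "x + y + z \<noteq> 0"
  proof
    assume 0: "x + y + z = 0"
    then have x: "x = - y - z" by simp
    have d: "y *\<^sub>R (?f P2 - ?f P1) + z *\<^sub>R (?f P3 - ?f P1) = 0"
      using eq unfolding 0 unfolding x by (simp add: algebra_simps)
    have "collinear {0, ?f P2 - ?f P1, ?f P3 - ?f P1}"
    proof (cases "z = 0")
      case True
      then show ?thesis using d nz x by (auto simp: collinear_lemma)
    next
      case False
      have "z *\<^sub>R (?f P3 - ?f P1) = (- y) *\<^sub>R (?f P2 - ?f P1)"
        using d by (simp add: eq_neg_iff_add_eq_0 add.commute)
      then have "?f P3 - ?f P1 = (- y / z) *\<^sub>R (?f P2 - ?f P1)"
        using False by (simp only: eq_vector_fraction_iff if_False)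
      then show ?thesis unfolding collinear_lemma by blast
    qed
    then show False using noncoll collinear_3_diff by blast
  qed
  moreover define k where "k = x + y + z"
  ultimately have k: "k \<noteq> 0" by simp
  have "k *\<^sub>R ?f P = k *\<^sub>R ((x / k) *\<^sub>R ?f P1 + (y / k) *\<^sub>R ?f P2 + (z / k) *\<^sub>R ?f P3)"
    using eq k by (simp add: k_def[symmetric] scaleR_add_right)
  then have "?f P = (x / k) *\<^sub>R ?f P1 + (y / k) *\<^sub>R ?f P2 + (z / k) *\<^sub>R ?f P3"
    using k by simp
  moreover have "x / k + y / k + z / k = 1"
    using k by (simp add: add_divide_distrib[symmetric] k_def[symmetric])
  ultimately show ?thesis unfolding affine_hull_3 by blast
qed

section \<open>Transfer of Pappus to Nil\<close>

theorem theorem2p9: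
  fixes S g\<^sub>a g\<^sub>b :: "nil set"
    and A1 A2 A3 B1 B2 B3 M1 M2 M3 :: nil
  assumes "nil_is_surface S"
    and "nil_is_curve g\<^sub>a" and "nil_is_curve g\<^sub>b" and "g\<^sub>a \<noteq> g\<^sub>b"
    and "g\<^sub>a \<subseteq> S" and "g\<^sub>b \<subseteq> S"
    and "A1 \<in> g\<^sub>a" and "A2 \<in> g\<^sub>a" and "A3 \<in> g\<^sub>a" and "distinct [A1, A2, A3]"
    and "B1 \<in> g\<^sub>b" and "B2 \<in> g\<^sub>b" and "B3 \<in> g\<^sub>b" and "distinct [B1, B2, B3]"
    and "A1 \<noteq> B1" and "A2 \<noteq> B2" and "A3 \<noteq> B3"
    and "A3 \<noteq> B2" and "A1 \<noteq> B3" and "A2 \<noteq> B1"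
    and "M1 \<in> nil_curve_through A1 B1 \<inter> nil_curve_through A3 B2"
    and "M2 \<in> nil_curve_through A2 B2 \<inter> nil_curve_through A1 B3"
    and "M3 \<in> nil_curve_through A3 B3 \<inter> nil_curve_through A2 B1"
  shows "\<exists>g. nil_is_curve g \<and> {M1, M2, M3} \<subseteq> g"
proof -
  let ?f = nil_straighten
  have inj: "?f X = ?f Y \<longleftrightarrow> X = Y" for X Y
    using inj_nil_straighten by (rule inj_eq)
  obtain P1 P2 P3 where P: "\<not> collinear {?f P1, ?f P2, ?f P3}" and S: "S = nil_surface P1 P2 P3"
    using assms(1) unfolding nil_is_surface_def subset_nil_curve_iff by auto
  \<comment> \<open>A line through all six images would come from one translation curve. Two
    distinct points determine such a curve, so it would equal both given ones.\<close>
  have noncoll: "\<not> collinear {?f A1, ?f A2, ?f A3, ?f B1, ?f B2, ?f B3}"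
  proof
    assume "collinear {?f A1, ?f A2, ?f A3, ?f B1, ?f B2, ?f B3}"
    then have "collinear (?f ` {A1, A2, A3, B1, B2, B3})" by simp
    then obtain g where g: "nil_is_curve g" "{A1, A2, A3, B1, B2, B3} \<subseteq> g"
      unfolding subset_nil_curve_iff[symmetric] by blast
    have "g\<^sub>a = g" using nil_is_curve_ex1[of A1 A2] g assms(2,7,8,10) by auto
    moreover have "g\<^sub>b = g" using nil_is_curve_ex1[of B1 B2] g assms(3,11,12,14) by auto
    ultimately show False using assms(4) by simp
  qed
  have plane: "{?f A1, ?f A2, ?f A3, ?f B1, ?f B2, ?f B3} \<subseteq> affine hull {?f P1, ?f P2, ?f P3}"
    using nil_surface_subset_plane[OF P] assms(5-9,11-13) unfolding S by blast
  have "collinear (?f ` {A1, A2, A3})" "collinear (?f ` {B1, B2, B3})"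
    unfolding subset_nil_curve_iff[symmetric] using assms(2,3,7-9,11-13) by blast+
  then have lines: "collinear {?f A1, ?f A2, ?f A3}" "collinear {?f B1, ?f B2, ?f B3}"
    by (simp_all only: image_insert image_empty)
  have M: "collinear {?f A1, ?f B1, ?f M1}" "collinear {?f A3, ?f B2, ?f M1}"
      "collinear {?f A2, ?f B2, ?f M2}" "collinear {?f A1, ?f B3, ?f M2}"
      "collinear {?f A3, ?f B3, ?f M3}" "collinear {?f A2, ?f B1, ?f M3}"
    using assms(15-) nil_curve_through_collinear by blast+
  have dist: "distinct [?f A1, ?f A2, ?f A3]" "distinct [?f B1, ?f B2, ?f B3]"
    using assms(10,14) by (simp_all add: inj)
  have ne: "?f A1 \<noteq> ?f B1" "?f A2 \<noteq> ?f B2" "?f A3 \<noteq> ?f B3"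
      "?f A3 \<noteq> ?f B2" "?f A1 \<noteq> ?f B3" "?f A2 \<noteq> ?f B1"
    using assms(15-20) by (simp_all add: inj)
  have "collinear {?f M1, ?f M2, ?f M3}"
    by (rule pappus[OF plane noncoll lines dist ne M])
  then show ?thesis
    unfolding subset_nil_curve_iff by simp
qed

end
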